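(* There exist absolute constants $C,K>0$ such that the following holds for every $\gamma>C$. (1) For all positive integers $M,k$ and all even $n\ge 4$, if $k>\gamma M^2\log(Mn)$, $v_0\in V(C_{n,k})$, and $f$ is chosen uniformly at random from $\mathrm{Lip}_{v_0}(C_{n,k};M)$, then $$\mathbb{P}\left(R(f)\le M+1\right)\ge 1-\frac{K}{\gamma}.$$ (2) Furthermore, if $M=M(n)$ and $k=k(n)$ are such that $k>\gamma M^2\log(Mn)$ and $\log M=o(\log n)$ as $n\to\infty$ ($n$ even), then for $f$ chosen uniformly at random from $\mathrm{Lip}_{v_0}(C_{n,k};M)$, $$\mathbb{P}\left(R(f)\le M+1\right)= 1-o(1)\quad\text{as } n\to\infty.$$
   Context: $\log$ denotes $\log_2$. For $n,k\in\mathbb{N}$ with $n$ even, $C_{n,k}$ is the graph with vertex set $[n]\times[k]$ in which $(u,u')$ and $(w,w')$ are adjacent iff $u$ and $w$ are consecutive modulo $n$, i.e. $u-w\equiv\pm1 \pmod n$. In other words, it is a cycle of $n$ layers, each layer having $k$ vertices and no internal edges, with complete bipartite graphs between cyclically consecutive layers. For a connected finite graph $G$, $v_0\in V(G)$ and a positive integer $M$, $\mathrm{Lip}_{v_0}(G;M)$ is the (finite) set of functions $f:V(G)\to\mathbb{Z}$ with $f(v_0)=0$ and $|f(u)-f(v)|\le M$ for all $\{u,v\}\in E(G)$. The range of $f$ is $R(f):=\max_{v\in V(G)}f(v)-\min_{v\in V(G)}f(v)+1$. *)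

theory Defs
  imports
    "Graph_Theory.Graph_Theory"
    "HOL-Number_Theory.Cong"
    "HOL-Library.FuncSet"
    "HOL-Library.Landau_Symbols"
    "HOL-Probability.Probability_Mass_Function"
begin

text \<open>Graphs are symmetric loop-free pair digraphs (locale \<open>pair_graph\<close>): an edge
  \<open>{u, v}\<close> is represented by the two arcs \<open>(u, v)\<close> and \<open>(v, u)\<close>.\<close>

definition layered_cycle :: "nat \<Rightarrow> nat \<Rightarrow> (nat \<times> nat) pair_pre_digraph" where
  "layered_cycle n k =
     \<lparr> pverts = {1..n} \<times> {1..k},
       parcs = {((u, u'), (w, w')). (u, u') \<in> {1..n} \<times> {1..k} \<and> (w, w') \<in> {1..n} \<times> {1..k} \<and>
                 ([int u - int w = 1] (mod int n) \<or> [int u - int w = -1] (mod int n))} \<rparr>"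

text \<open>A function on the vertex set is represented by its extension by \<open>undefined\<close> outside the
  vertex set, so that distinct elements of \<open>Lip G v0 M\<close> are distinct functions on the vertices.\<close>

definition Lip :: "'a pair_pre_digraph \<Rightarrow> 'a \<Rightarrow> nat \<Rightarrow> ('a \<Rightarrow> int) set" where
  "Lip G v0 M =
     {f \<in> pverts G \<rightarrow>\<^sub>E UNIV. f v0 = 0 \<and> (\<forall>(u, v) \<in> parcs G. \<bar>f u - f v\<bar> \<le> int M)}"

definition range_size :: "'a pair_pre_digraph \<Rightarrow> ('a \<Rightarrow> int) \<Rightarrow> int" where
  "range_size G f = Max (f ` pverts G) - Min (f ` pverts G) + 1"

definition prob_small_range :: "nat \<Rightarrow> nat \<Rightarrow> nat \<times> nat \<Rightarrow> nat \<Rightarrow> real" where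
  "prob_small_range n k v0 M =
     measure_pmf.prob (pmf_of_set (Lip (layered_cycle n k) v0 M))
       {f. range_size (layered_cycle n k) f \<le> int M + 1}"

definition even_at_top :: "nat filter" where
  "even_at_top = inf at_top (principal {n. even n})"

text \<open>The facts below ensure that the uniform distribution \<open>pmf_of_set\<close> is meaningful here:
  it is only specified for finite nonempty sets.\<close>

lemma pair_graph_layered_cycle:
  assumes "n \<noteq> 1"
  shows "pair_graph (layered_cycle n k)"
proof
  show "finite (parcs (layered_cycle n k))"
    by (rule finite_subset[of _ "({1..n} \<times> {1..k}) \<times> ({1..n} \<times> {1..k})"])
       (auto simp: layered_cycle_def)
  have *: "[int u - int w = 1] (mod int n) \<Longrightarrow> [int w - int u = - 1] (mod int n)" for u w
    using cong_minus_minus_iff[of "int u - int w" 1 "int n"] by simp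
  have **: "[int u - int w = - 1] (mod int n) \<Longrightarrow> [int w - int u = 1] (mod int n)" for u w
    using cong_minus_minus_iff[of "int u - int w" "-1" "int n"] by simp
  show "symmetric (with_proj (layered_cycle n k))"
    by (auto simp: symmetric_def layered_cycle_def intro!: symI intro: * **)
  have "\<not> [0 = 1] (mod int n)" "\<not> [0 = - 1] (mod int n)"
    using assms by (auto simp: cong_iff_dvd_diff)
  then show "e \<in> parcs (layered_cycle n k) \<Longrightarrow> fst e \<noteq> snd e" for e
    by (auto simp: layered_cycle_def)
qed (auto simp: layered_cycle_def)

lemma strongly_connected_layered_cycle:
  assumes "n \<ge> 2" "k \<ge> 1"
  shows "strongly_connected (layered_cycle n k)"
proof -
  let ?G = "layered_cycle n k"
  interpret pair_graph ?G
    using assms by (intro pair_graph_layered_cycle) auto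
  have arc: "((a, b), (Suc a, b')) \<in> parcs ?G"
    if "a \<ge> 1" "Suc a \<le> n" "b \<in> {1..k}" "b' \<in> {1..k}" for a b b'
    using that by (auto simp: layered_cycle_def)
  have arc': "((Suc a, b), (a, b')) \<in> parcs ?G"
    if "a \<ge> 1" "Suc a \<le> n" "b \<in> {1..k}" "b' \<in> {1..k}" for a b b'
    using that by (auto simp: layered_cycle_def)
  have base: "(1, 1) \<rightarrow>\<^sup>*\<^bsub>with_proj ?G\<^esub> (Suc a, b)" if "Suc a \<le> n" "b \<in> {1..k}" for a b
    using that
  proof (induction a arbitrary: b)
    case 0
    have "(1, 1) \<rightarrow>\<^sup>*\<^bsub>with_proj ?G\<^esub> (Suc 1, 1)"
      by (rule reachable_adjI) (use arc[of 1 1 1] assms in simp)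
    also have "(Suc 1, 1) \<rightarrow>\<^sup>*\<^bsub>with_proj ?G\<^esub> (1, b)"
      by (rule reachable_adjI) (use arc'[of 1 1 b] assms 0 in simp)
    finally show ?case by simp
  next
    case (Suc a)
    have "(1, 1) \<rightarrow>\<^sup>*\<^bsub>with_proj ?G\<^esub> (Suc a, b)"
      using Suc by simp
    also have "(Suc a, b) \<rightarrow>\<^sup>*\<^bsub>with_proj ?G\<^esub> (Suc (Suc a), b)"
      by (rule reachable_adjI) (use arc[of "Suc a" b b] Suc in simp)
    finally show ?case .
  qed
  have root: "(1, 1) \<rightarrow>\<^sup>*\<^bsub>with_proj ?G\<^esub> v" if "v \<in> pverts ?G" for v
  proof -
    obtain a b where v: "v = (a, b)" by (cases v)
    with that have "a \<ge> 1" "a \<le> n" "b \<in> {1..k}"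
      by (auto simp: layered_cycle_def)
    with base[of "a - 1" b] v show ?thesis by simp
  qed
  show ?thesis
  proof
    show "verts (with_proj ?G) \<noteq> {}"
      using assms by (auto simp: layered_cycle_def)
    show "u \<rightarrow>\<^sup>*\<^bsub>with_proj ?G\<^esub> v"
      if "u \<in> verts (with_proj ?G)" "v \<in> verts (with_proj ?G)" for u v
    proof -
      have "u \<rightarrow>\<^sup>*\<^bsub>with_proj ?G\<^esub> (1, 1)"
        by (rule symmetric_reachable', rule root) (use that in simp)
      also have "(1, 1) \<rightarrow>\<^sup>*\<^bsub>with_proj ?G\<^esub> v"
        using root[of v] that by simp
      finally show ?thesis .
    qed
  qed
qed

lemma finite_Lip:
  assumes "pair_graph G" "strongly_connected (with_proj G)" "v0 \<in> pverts G"
  shows "finite (Lip G v0 M)"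
proof -
  interpret pair_graph G by fact
  have ex: "\<exists>B. \<forall>f \<in> Lip G v0 M. \<bar>f u\<bar> \<le> B" if "u \<in> pverts G" for u
  proof -
    have "v0 \<rightarrow>\<^sup>*\<^bsub>with_proj G\<^esub> u"
      using assms that by (auto simp: strongly_connected_def)
    then show ?thesis
    proof (induction rule: reachable_induct)
      case base
      show ?case by (intro exI[of _ 0]) (auto simp: Lip_def)
    next
      case (step x y)
      then obtain B where B: "\<forall>f \<in> Lip G v0 M. \<bar>f x\<bar> \<le> B" by blast
      have "\<bar>f y\<bar> \<le> B + int M" if f: "f \<in> Lip G v0 M" for f
      proof -
        have "\<bar>f x - f y\<bar> \<le> int M" using f step by (auto simp: Lip_def)
        moreover have "\<bar>f x\<bar> \<le> B" using f B by blast
        ultimately show ?thesis by linarith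
      qed
      then show ?case by blast
    qed
  qed
  then obtain B where B: "\<forall>u \<in> pverts G. \<forall>f \<in> Lip G v0 M. \<bar>f u\<bar> \<le> B u"
    by metis
  have "Lip G v0 M \<subseteq> pverts G \<rightarrow>\<^sub>E {z. \<exists>u \<in> pverts G. \<bar>z\<bar> \<le> B u}"
  proof
    fix f assume f: "f \<in> Lip G v0 M"
    then have "f \<in> extensional (pverts G)" by (simp add: Lip_def PiE_iff)
    moreover have "\<exists>u \<in> pverts G. \<bar>f x\<bar> \<le> B u" if "x \<in> pverts G" for x
      using B f that by blast
    ultimately show "f \<in> pverts G \<rightarrow>\<^sub>E {z. \<exists>u \<in> pverts G. \<bar>z\<bar> \<le> B u}"
      by (simp add: PiE_iff)
  qed
  moreover have "finite {z :: int. \<exists>u \<in> pverts G. \<bar>z\<bar> \<le> B u}"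
  proof -
    have "{z. \<exists>u \<in> pverts G. \<bar>z\<bar> \<le> B u} \<subseteq> (\<Union>u \<in> pverts G. {- B u..B u})"
      by (auto simp: abs_le_iff intro!: bexI)
    then show ?thesis
      using pair_finite_verts by (meson finite_UN finite_atLeastAtMost_int finite_subset)
  qed
  ultimately show ?thesis
    by (meson finite_PiE finite_subset pair_finite_verts)
qed

lemma Lip_nonempty:
  assumes "pair_wf_digraph G" "v0 \<in> pverts G"
  shows "Lip G v0 M \<noteq> {}"
proof -
  interpret pair_wf_digraph G by fact
  have "restrict (\<lambda>_. 0) (pverts G) \<in> Lip G v0 M"
    using assms(2) by (auto simp: Lip_def dest: in_arcsD1 in_arcsD2)
  then show ?thesis by blast
qed

end

theory Submission
  imports Defs
begin

text \<open>
  Record for a function \<open>f\<close> the interval of integers spanned by its values on each layer. The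
  Lipschitz condition speaks about these intervals alone: for consecutive layers with spans
  \<open>[a, b]\<close> and \<open>[c, d]\<close> it says that \<open>b - c\<close> and \<open>d - a\<close> are at most \<open>M\<close>. The two widths
  (numbers of integers) thus add up to at most \<open>2(M + 1)\<close>, so their product is at most
  \<open>(M + 1)\<^sup>2\<close>, and being an integer it is at most \<open>(M + 1)\<^sup>2 - 1\<close> unless both spans are one and
  the same interval of width \<open>M + 1\<close> (lemma \<open>width_product_le\<close>). Call such a pair saturated. If all
  consecutive pairs are saturated, all values lie in a single interval of width \<open>M + 1\<close>; hence a
  function with \<open>R(f) > M + 1\<close> has an unsaturated pair.

  A sequence of spans of widths \<open>w\<^sub>1, \<dots>, w\<^sub>n\<close> is shared by at most
  \<open>\<Prod>\<^sub>i w\<^sub>i\<^sup>k = \<Prod>\<^sub>i (w\<^sub>i w\<^sub>i\<^sub>+\<^sub>1)\<^bsup>k/2\<^esup>\<close> functions, the indices being cyclic. Relative to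
  \<open>(M + 1)\<^bsup>nk\<^esup>\<close>, every unsaturated pair costs a factor \<open>(1 - (M + 1)\<^sup>-\<^sup>2)\<^bsup>k/2\<^esup> \<le> \<delta>\<^sup>2\<close>, where
  \<open>\<delta> = exp (- k / (4 (M + 1)\<^sup>2))\<close>. For a function of large range one factor \<open>\<delta>\<close> is set aside, and
  one factor \<open>\<delta>\<close> per unsaturated pair is kept to pay for the number of sequences: since a
  span changes only at unsaturated pairs and the spans range over a set of
  \<open>c = (2Mn + 1)\<^sup>2\<close> pairs of endpoints, the weights of all sequences
  sum to at most \<open>c (1 + c\<delta>)\<^bsup>n-1\<^esup>\<close> (lemma \<open>sum_walks_le\<close>). So at most
  \<open>(M + 1)\<^bsup>nk\<^esup> \<delta> c (1 + c\<delta>)\<^bsup>n-1\<^esup>\<close> functions have large range (lemma \<open>card_large_range_le\<close>),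
  whereas \<open>(M + 1)\<^bsup>nk-1\<^esup>\<close> functions have all their values in \<open>{0..M}\<close> (lemma \<open>card_Lip_ge\<close>).

  If \<open>k > \<gamma> M\<^sup>2 log (Mn)\<close>, then \<open>\<delta> \<le> (Mn)\<^bsup>-\<gamma>/16\<^esup>\<close>, which beats every polynomial factor above
  once \<open>\<gamma>\<close> is large. The failure probability is then at most \<open>(Mn)\<^bsup>-\<gamma>/32\<^esup>\<close> (lemma
  \<open>failure_bound_le\<close>), and this single bound is both at most \<open>32/\<gamma>\<close> and at most \<open>1/n\<close>.
\<close>

section \<open>Sums over walks\<close>

text \<open>
  Summing over the last position first: staying put contributes \<open>1\<close> and the jumps contribute at
  most \<open>\<delta>\<close> per element of \<open>Y\<close>, so each further step multiplies the sum by at most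
  \<open>1 + card Y * \<delta>\<close>. The first factor \<open>card Y\<close> counts the starting points.
\<close>

lemma sum_walks_le:
  fixes Y :: "'a set" and \<delta> :: real
  assumes "finite Y" "\<delta> \<ge> 0" "n \<ge> 1"
  shows "(\<Sum>s \<in> {1..n} \<rightarrow>\<^sub>E Y. \<Prod>i\<in>{1..<n}. if s i = s (Suc i) then 1 else \<delta>)
           \<le> card Y * (1 + card Y * \<delta>) ^ (n - 1)"
  using assms(3)
proof (induction n rule: nat_induct_at_least)
  case base
  show ?case using assms(1) by (simp add: card_PiE)
next
  case (Suc n)
  let ?\<phi> = "\<lambda>x y. if x = y then 1 else \<delta>"
  let ?W = "\<lambda>n s. \<Prod>i\<in>{1..<n}. ?\<phi> (s i) (s (Suc i))"
  have new: "(\<Sum>y\<in>Y. ?\<phi> x y) \<le> 1 + card Y * \<delta>" for x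
  proof -
    have "(\<Sum>y\<in>Y. ?\<phi> x y) \<le> (\<Sum>y\<in>Y. (if y = x then 1 else 0) + \<delta>)"
      using assms(2) by (intro sum_mono) auto
    also have "\<dots> \<le> 1 + card Y * \<delta>"
      using assms(1) by (simp add: sum.distrib sum.delta)
    finally show ?thesis .
  qed
  have ext: "{1..Suc n} \<rightarrow>\<^sub>E Y
      = (\<lambda>(y, s). s(Suc n := y)) ` (Y \<times> ({1..n} \<rightarrow>\<^sub>E Y))"
    using PiE_insert_eq[of "Suc n" "{1..n}" "\<lambda>_. Y"] Suc.hyps
    by (simp add: atLeastAtMostSuc_conv)
  have inj: "inj_on (\<lambda>(y, s). s(Suc n := y)) (Y \<times> ({1..n} \<rightarrow>\<^sub>E Y))"
    using inj_combinator[of "Suc n" "{1..n}" "\<lambda>_. Y"] by simp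
  have W: "?W (Suc n) (s(Suc n := y)) = ?W n s * ?\<phi> (s n) y" for s y
  proof -
    have "?W (Suc n) (s(Suc n := y)) = ?W n (s(Suc n := y)) * ?\<phi> (s n) y"
      using Suc.hyps by (simp add: prod.atLeastLessThan_Suc)
    also have "?W n (s(Suc n := y)) = ?W n s" by (intro prod.cong) auto
    finally show ?thesis .
  qed
  have "(\<Sum>s \<in> {1..Suc n} \<rightarrow>\<^sub>E Y. ?W (Suc n) s)
      = (\<Sum>(y, s) \<in> Y \<times> ({1..n} \<rightarrow>\<^sub>E Y). ?W n s * ?\<phi> (s n) y)"
    unfolding ext by (subst sum.reindex[OF inj]) (simp only: case_prod_unfold comp_def W)
  also have "\<dots> = (\<Sum>s \<in> {1..n} \<rightarrow>\<^sub>E Y. ?W n s * (\<Sum>y\<in>Y. ?\<phi> (s n) y))"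
    by (subst sum.cartesian_product[symmetric], subst sum.swap) (simp only: sum_distrib_left)
  also have "\<dots> \<le> (\<Sum>s \<in> {1..n} \<rightarrow>\<^sub>E Y. ?W n s * (1 + card Y * \<delta>))"
    using assms(2) by (intro sum_mono mult_left_mono new prod_nonneg) auto
  also have "\<dots> = (\<Sum>s \<in> {1..n} \<rightarrow>\<^sub>E Y. ?W n s) * (1 + card Y * \<delta>)"
    by (simp only: sum_distrib_right)
  also have "\<dots> \<le> card Y * (1 + card Y * \<delta>) ^ (n - 1) * (1 + card Y * \<delta>)"
    using assms(2) by (intro mult_right_mono Suc.IH) auto
  also have "\<dots> = card Y * (1 + card Y * \<delta>) ^ (Suc n - 1)"
    using Suc.hyps by (cases n) auto
  finally show ?case .
qed

section \<open>Cyclic sequences of intervals\<close>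

text \<open>
  On the index set \<open>{1..n}\<close> the cyclic successor of \<open>i\<close> is \<open>i mod n + 1\<close>, which sends \<open>n\<close> to \<open>1\<close>.
\<close>

lemma bij_betw_cyclic_succ:
  assumes "n \<ge> (1::nat)"
  shows "bij_betw (\<lambda>i. i mod n + 1) {1..n} {1..n}"
proof -
  have "inj_on (\<lambda>i. i mod n + 1) {1..n}"
  proof (rule inj_onI)
    fix i j assume ij: "i \<in> {1..n}" "j \<in> {1..n}" "i mod n + 1 = j mod n + 1"
    show "i = j"
      using ij by (cases "i = n"; cases "j = n") auto
  qed
  moreover have "(\<lambda>i. i mod n + 1) ` {1..n} \<subseteq> {1..n}"
    using assms by (auto simp: Suc_le_eq)
  ultimately show ?thesis
    by (simp add: bij_betw_def endo_inj_surj)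
qed

text \<open>
  Adding the last two hypotheses bounds the sum of the widths by \<open>2(M + 1)\<close>, and the product is
  controlled through \<open>4xy = (x + y)\<^sup>2 - (x - y)\<^sup>2\<close>. If the sum attains its bound, both hypotheses
  are equalities; equal widths then force the two intervals to coincide and have width \<open>M + 1\<close>,
  and unequal widths lose at least \<open>1\<close> in \<open>4xy\<close>, hence in the integer \<open>xy\<close>.
\<close>

lemma width_product_le:
  fixes a b c d M :: int
  assumes "a \<le> b" "c \<le> d" "b - c \<le> M" "d - a \<le> M"
  shows "(b - a + 1) * (d - c + 1) \<le> (M + 1)\<^sup>2"
    and "\<not> ((a, b) = (c, d) \<and> b - a = M) \<Longrightarrow> (b - a + 1) * (d - c + 1) \<le> (M + 1)\<^sup>2 - 1"
proof -
  define x where "x = b - a + 1"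
  define y where "y = d - c + 1"
  have xy: "x \<ge> 1" "y \<ge> 1" "x + y \<le> 2 * (M + 1)"
    using assms by (auto simp: x_def y_def)
  have amgm: "4 * (x * y) = (x + y)\<^sup>2 - (x - y)\<^sup>2"
    by (simp add: power2_eq_square algebra_simps)
  have "(x + y)\<^sup>2 \<le> (2 * (M + 1))\<^sup>2"
    using xy by (intro power_mono) auto
  then have "(x + y)\<^sup>2 \<le> 4 * (M + 1)\<^sup>2" unfolding power_mult_distrib by simp
  then have "x * y \<le> (M + 1)\<^sup>2"
    using amgm zero_le_power2[of "x - y"] by linarith
  then show "(b - a + 1) * (d - c + 1) \<le> (M + 1)\<^sup>2"
    unfolding x_def y_def .
  assume ng: "\<not> ((a, b) = (c, d) \<and> b - a = M)"
  show "(b - a + 1) * (d - c + 1) \<le> (M + 1)\<^sup>2 - 1"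
  proof (cases "x + y = 2 * (M + 1)")
    case False
    have "(x + y)\<^sup>2 \<le> (2 * M + 1)\<^sup>2"
      using xy False by (intro power_mono) auto
    then have "4 * (x * y) \<le> 4 * (M\<^sup>2 + M) + 1"
      using amgm zero_le_power2[of "x - y"] by (simp add: power2_eq_square algebra_simps)
    moreover have "4 * u \<le> 4 * v + 1 \<Longrightarrow> u \<le> v" for u v :: int by presburger
    ultimately have "x * y \<le> M\<^sup>2 + M" by blast
    moreover have "M \<ge> 0" using xy by simp
    ultimately show ?thesis
      unfolding x_def y_def by (simp add: power2_eq_square algebra_simps)
  next
    case True
    then have "b - c = M" "d - a = M" using assms by (auto simp: x_def y_def)
    with ng have "x - y \<noteq> 0" by (auto simp: x_def y_def)
    then have "(x - y)\<^sup>2 > 0" by simp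
    moreover have "(x + y)\<^sup>2 = 4 * (M + 1)\<^sup>2" unfolding True power_mult_distrib by simp
    ultimately have "4 * (x * y) < 4 * (M + 1)\<^sup>2" using amgm by linarith
    then show ?thesis unfolding x_def y_def by linarith
  qed
qed

definition width :: "int \<times> int \<Rightarrow> real" where
  "width I = of_int (snd I - fst I + 1)"

definition saturated :: "nat \<Rightarrow> int \<times> int \<Rightarrow> int \<times> int \<Rightarrow> bool" where
  "saturated M I J \<longleftrightarrow> I = J \<and> snd I - fst I = int M"

definition admissible :: "nat \<Rightarrow> int \<times> int \<Rightarrow> int \<times> int \<Rightarrow> bool" where
  "admissible M I J \<longleftrightarrow> fst I \<le> snd I \<and> fst J \<le> snd J \<and>
     snd I - fst J \<le> int M \<and> snd J - fst I \<le> int M"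

text \<open>
  The bound is written as a square because every layer belongs to two consecutive pairs: the
  product of the left-hand sides around the cycle is the square of the quantity of interest. An
  unsaturated pair has a product of widths at most \<open>N - 1 = N(1 - 1/N)\<close> with \<open>N = (M + 1)\<^sup>2\<close>, and
  \<open>(1 - 1/N)\<^sup>k \<le> exp (- k/N) = \<delta>\<^sup>4\<close>.
\<close>

lemma width_power_product_le:
  assumes "admissible M I J" "\<delta> = exp (- real k / (4 * (real M + 1)\<^sup>2))"
  shows "(width I * width J) ^ k \<le> ((real M + 1) ^ k * (if saturated M I J then 1 else \<delta>)\<^sup>2)\<^sup>2"
proof -
  obtain a b c d where IJ: "I = (a, b)" "J = (c, d)" by (metis surj_pair)
  note adm = assms(1)[unfolded admissible_def IJ, simplified]
  have w: "width I * width J = of_int ((b - a + 1) * (d - c + 1))"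
    by (simp add: width_def IJ)
  have pos: "0 \<le> width I * width J" using adm unfolding width_def IJ by (intro mult_nonneg_nonneg) auto
  define N where "N = (real M + 1)\<^sup>2"
  have N: "N > 0" "N = of_int ((int M + 1)\<^sup>2)" by (auto simp: N_def)
  show ?thesis
  proof (cases "saturated M I J")
    case True
    have "width I * width J \<le> N"
      using width_product_le(1)[of a b c d "int M"] adm unfolding w N(2) of_int_le_iff by blast
    then have "(width I * width J) ^ k \<le> N ^ k" using pos by (rule power_mono)
    then show ?thesis using True by (simp add: N_def flip: power_mult add: mult.commute)
  next
    case False
    have "width I * width J \<le> N - 1"
    proof -
      have "(b - a + 1) * (d - c + 1) \<le> (int M + 1)\<^sup>2 - 1"
        using width_product_le(2)[of a b c d "int M"] adm False
        unfolding saturated_def IJ by auto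
      then have "real_of_int ((b - a + 1) * (d - c + 1)) \<le> of_int ((int M + 1)\<^sup>2 - 1)"
        by (subst of_int_le_iff)
      then show ?thesis unfolding w N(2) by simp
    qed
    also have "N - 1 = N * (1 + (- 1 / N))" using N by (simp add: field_simps)
    also have "\<dots> \<le> N * exp (- 1 / N)"
      using N by (intro mult_left_mono exp_ge_add_one_self) auto
    finally have "(width I * width J) ^ k \<le> (N * exp (- 1 / N)) ^ k" using pos by (rule power_mono)
    also have "\<dots> = N ^ k * exp (- real k / N)"
      by (simp add: power_mult_distrib flip: exp_of_nat_mult)
    also have "exp (- real k / N) = \<delta> ^ 4"
      unfolding assms(2) by (simp add: N_def flip: exp_of_nat_mult)
    finally show ?thesis
      using False by (simp add: N_def power_mult_distrib flip: power_mult add: mult.commute)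
  qed
qed

text \<open>
  Multiplying the previous bound around the cycle and taking the square root gives two factors
  \<open>\<delta>\<close> for every unsaturated pair, that is, the square of the product of the \<open>g i\<close> below. One of
  the two copies is weakened to a single \<open>\<delta>\<close>, paid by the assumed unsaturated pair. In the
  other copy the closing pair \<open>(n, 1)\<close> is dropped and unsaturated pairs with equal intervals are
  forgiven, which turns it into the weight of a walk.
\<close>

lemma width_product_cycle_le:
  fixes s :: "nat \<Rightarrow> int \<times> int"
  assumes n: "n \<ge> 1"
    and adm: "\<And>i. i \<in> {1..n} \<Longrightarrow> admissible M (s i) (s (i mod n + 1))"
    and defect: "\<exists>i\<in>{1..n}. \<not> saturated M (s i) (s (i mod n + 1))"
    and \<delta>: "\<delta> = exp (- real k / (4 * (real M + 1)\<^sup>2))"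
  shows "(\<Prod>i\<in>{1..n}. width (s i) ^ k)
    \<le> (real M + 1) ^ (n * k) * \<delta> * (\<Prod>i\<in>{1..<n}. if s i = s (Suc i) then 1 else \<delta>)"
proof -
  let ?nx = "\<lambda>i. i mod n + 1"
  define P where "P = (\<Prod>i\<in>{1..n}. width (s i) ^ k)"
  define g where "g i = (if saturated M (s i) (s (?nx i)) then 1 else \<delta>)" for i
  define A where "A = (real M + 1) ^ (n * k)"
  have \<delta>01: "0 \<le> \<delta>" "\<delta> \<le> 1" unfolding \<delta> by auto
  have g01: "0 \<le> g i" "g i \<le> 1" for i using \<delta>01 by (auto simp: g_def)
  have w0: "width (s i) \<ge> 0" if "i \<in> {1..n}" for i
    using adm[OF that] by (auto simp: width_def admissible_def)
  have shift: "P = (\<Prod>i\<in>{1..n}. width (s (?nx i)) ^ k)"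
    unfolding P_def by (rule prod.reindex_bij_betw[OF bij_betw_cyclic_succ[OF n], symmetric])
  have "P\<^sup>2 = (\<Prod>i\<in>{1..n}. width (s i) ^ k) * (\<Prod>i\<in>{1..n}. width (s (?nx i)) ^ k)"
    unfolding power2_eq_square using shift P_def by simp
  also have "\<dots> = (\<Prod>i\<in>{1..n}. (width (s i) * width (s (?nx i))) ^ k)"
    by (simp add: prod.distrib power_mult_distrib)
  also have "\<dots> \<le> (\<Prod>i\<in>{1..n}. ((real M + 1) ^ k * (g i)\<^sup>2)\<^sup>2)"
  proof (intro prod_mono conjI)
    fix i assume i: "i \<in> {1..n}"
    have "?nx i \<in> {1..n}" using bij_betw_apply[OF bij_betw_cyclic_succ[OF n] i] .
    then show "0 \<le> (width (s i) * width (s (?nx i))) ^ k" using w0 i by simp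
    show "(width (s i) * width (s (?nx i))) ^ k \<le> ((real M + 1) ^ k * (g i)\<^sup>2)\<^sup>2"
      unfolding g_def by (rule width_power_product_le[OF adm[OF i] \<delta>])
  qed
  also have "\<dots> = (A * (\<Prod>i\<in>{1..n}. g i)\<^sup>2)\<^sup>2"
    by (simp add: A_def prod.distrib prod_power_distrib power_mult_distrib
        flip: power_mult add: ac_simps)
  finally have "P \<le> A * (\<Prod>i\<in>{1..n}. g i)\<^sup>2"
    by (rule power2_le_imp_le) (simp add: A_def)
  also have "(\<Prod>i\<in>{1..n}. g i)\<^sup>2 \<le> \<delta> * (\<Prod>i\<in>{1..<n}. if s i = s (Suc i) then 1 else \<delta>)"
    unfolding power2_eq_square
  proof (intro mult_mono)
    from defect obtain i0 where i0: "i0 \<in> {1..n}" "g i0 = \<delta>" by (auto simp: g_def)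
    have "(\<Prod>i\<in>{1..n}. g i) = g i0 * (\<Prod>i\<in>{1..n} - {i0}. g i)"
      using i0(1) by (intro prod.remove) auto
    also have "\<dots> \<le> \<delta> * 1"
      unfolding i0(2) using g01 \<delta>01 by (intro mult_left_mono prod_le_1) auto
    finally show "(\<Prod>i\<in>{1..n}. g i) \<le> \<delta>" by simp
    have "{1..n} = insert n {1..<n}" using n by auto
    then have "(\<Prod>i\<in>{1..n}. g i) = g n * (\<Prod>i\<in>{1..<n}. g i)" by simp
    also have "\<dots> \<le> 1 * (\<Prod>i\<in>{1..<n}. g i)"
      using g01 by (intro mult_right_mono prod_nonneg) auto
    also have "\<dots> \<le> 1 * (\<Prod>i\<in>{1..<n}. if s i = s (Suc i) then 1 else \<delta>)"
      using \<delta>01 by (intro mult_left_mono prod_mono) (auto simp: g_def saturated_def)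
    finally show "(\<Prod>i\<in>{1..n}. g i) \<le> (\<Prod>i\<in>{1..<n}. if s i = s (Suc i) then 1 else \<delta>)" by simp
  qed (use g01 \<delta>01 in \<open>auto intro: prod_nonneg\<close>)
  finally show ?thesis by (simp add: A_def P_def mult.assoc mult_left_mono)
qed


section \<open>The profile of a Lipschitz function\<close>

definition layer_span :: "nat \<Rightarrow> (nat \<times> nat \<Rightarrow> int) \<Rightarrow> nat \<Rightarrow> int \<times> int" where
  "layer_span k f i = (Min ((\<lambda>p. f (i, p)) ` {1..k}), Max ((\<lambda>p. f (i, p)) ` {1..k}))"

lemma layer_span_bounds:
  assumes "p \<in> {1..k}"
  shows "fst (layer_span k f i) \<le> f (i, p)" "f (i, p) \<le> snd (layer_span k f i)"
  using assms by (auto simp: layer_span_def)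

lemma layer_span_attained:
  assumes "k \<ge> 1"
  obtains p q where "p \<in> {1..k}" "f (i, p) = fst (layer_span k f i)"
    "q \<in> {1..k}" "f (i, q) = snd (layer_span k f i)"
proof -
  let ?V = "(\<lambda>p. f (i, p)) ` {1..k}"
  have "Min ?V \<in> ?V" "Max ?V \<in> ?V" using assms by (auto intro!: Min_in Max_in)
  then show ?thesis using that by (auto simp: layer_span_def)
qed

lemma Lip_cyclic_edge:
  assumes "f \<in> Lip (layered_cycle n k) v0 M" "i \<in> {1..n}" "p \<in> {1..k}" "q \<in> {1..k}"
  shows "\<bar>f (i, p) - f (i mod n + 1, q)\<bar> \<le> int M"
proof -
  have "[int i - int (i mod n + 1) = - 1] (mod int n)"
    using assms(2) by (cases "i = n") (auto simp: cong_iff_dvd_diff)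
  moreover have "i mod n + 1 \<in> {1..n}"
    using assms(2) by (auto simp: Suc_le_eq)
  ultimately have "((i, p), (i mod n + 1, q)) \<in> parcs (layered_cycle n k)"
    using assms by (auto simp: layered_cycle_def)
  then show ?thesis using assms(1) by (auto simp: Lip_def)
qed

lemma admissible_layer_span:
  assumes "f \<in> Lip (layered_cycle n k) v0 M" "i \<in> {1..n}" "k \<ge> 1"
  shows "admissible M (layer_span k f i) (layer_span k f (i mod n + 1))"
proof -
  let ?j = "i mod n + 1"
  obtain p q where pq: "p \<in> {1..k}" "f (i, p) = fst (layer_span k f i)"
    "q \<in> {1..k}" "f (i, q) = snd (layer_span k f i)"
    by (rule layer_span_attained[OF assms(3)])
  obtain p' q' where pq': "p' \<in> {1..k}" "f (?j, p') = fst (layer_span k f ?j)"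
    "q' \<in> {1..k}" "f (?j, q') = snd (layer_span k f ?j)"
    by (rule layer_span_attained[OF assms(3)])
  have "fst (layer_span k f i) \<le> snd (layer_span k f i)"
    "fst (layer_span k f ?j) \<le> snd (layer_span k f ?j)"
    using layer_span_bounds[OF pq(1), of f] by (meson order_trans)+
  then show ?thesis
    using Lip_cyclic_edge[OF assms(1,2) pq(1) pq'(3)] Lip_cyclic_edge[OF assms(1,2) pq(3) pq'(1)]
      pq pq' unfolding admissible_def by linarith
qed

text \<open>
  Saturation of all pairs propagates the span of the first layer to all the others.
\<close>

lemma saturated_imp_small_range:
  assumes "n \<ge> 1" "k \<ge> 1"
    and sat: "\<And>i. i \<in> {1..n} \<Longrightarrow> saturated M (layer_span k f i) (layer_span k f (i mod n + 1))"
  shows "range_size (layered_cycle n k) f \<le> int M + 1"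
proof -
  let ?V = "f ` pverts (layered_cycle n k)"
  have same: "layer_span k f i = layer_span k f 1" if "i \<ge> 1" "i \<le> n" for i
    using that
  proof (induction i rule: nat_induct_at_least)
    case (Suc i)
    then show ?case using sat[of i] by (simp add: saturated_def)
  qed simp
  have V: "finite ?V" "?V \<noteq> {}" using assms(1,2) by (auto simp: layered_cycle_def)
  have "Min ?V \<in> ?V" "Max ?V \<in> ?V" using V by (auto intro!: Min_in Max_in)
  moreover have "fst (layer_span k f 1) \<le> x \<and> x \<le> snd (layer_span k f 1)" if "x \<in> ?V" for x
  proof -
    from that obtain i p where "i \<in> {1..n}" "p \<in> {1..k}" "x = f (i, p)"
      by (auto simp: layered_cycle_def)
    then show ?thesis using layer_span_bounds[of p k f i] same[of i] by auto
  qed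
  ultimately have "fst (layer_span k f 1) \<le> Min ?V" "Max ?V \<le> snd (layer_span k f 1)" by blast+
  then show ?thesis
    using sat[of 1] assms(1) by (auto simp: range_size_def saturated_def)
qed

text \<open>
  Distinct layers \<open>i\<close> and \<open>j\<close> are joined by a path of \<open>\<bar>i - j\<bar> < n\<close> edges. Two vertices of the
  same layer are joined by two edges through a neighbouring layer, whence the bound on \<open>n\<close>.
\<close>

lemma Lip_abs_le:
  assumes f: "f \<in> Lip (layered_cycle n k) v0 M" and n: "n \<ge> 2"
    and v0: "v0 \<in> pverts (layered_cycle n k)" and v: "v \<in> pverts (layered_cycle n k)"
  shows "\<bar>f v\<bar> \<le> int M * int n"
proof -
  have dist: "\<bar>f (i, p) - f (i + d, q)\<bar> \<le> int M * int d"
    if "d \<ge> 1" "i \<ge> 1" "i + d \<le> n" "p \<in> {1..k}" "q \<in> {1..k}" for i d p q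
    using that
  proof (induction d arbitrary: q rule: nat_induct_at_least)
    case base
    then show ?case using Lip_cyclic_edge[OF f, of i p q] by simp
  next
    case (Suc d)
    have "\<bar>f (i, p) - f (i + d, p)\<bar> \<le> int M * int d"
      using Suc by simp
    moreover have "\<bar>f (i + d, p) - f (i + Suc d, q)\<bar> \<le> int M"
      using Lip_cyclic_edge[OF f, of "i + d" p q] Suc by simp
    ultimately show ?case by (simp add: algebra_simps)
  qed
  obtain i p j q where vw: "v = (i, p)" "v0 = (j, q)" by (metis surj_pair)
  have ij: "i \<in> {1..n}" "p \<in> {1..k}" "j \<in> {1..n}" "q \<in> {1..k}"
    using v v0 unfolding vw by (auto simp: layered_cycle_def)
  have mono: "int M * int d \<le> int M * int n" if "d \<le> n" for d
    using that by (intro mult_left_mono) auto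
  have "\<bar>f (i, p) - f (j, q)\<bar> \<le> int M * int n"
  proof (cases i j rule: linorder_cases)
    case less
    then obtain d where d: "j = i + d" "d \<ge> 1" by (metis less_imp_add_positive One_nat_def Suc_leI)
    then have "\<bar>f (i, p) - f (j, q)\<bar> \<le> int M * int d" using dist[of d i p q] ij by simp
    then show ?thesis using mono[of d] d ij by simp
  next
    case greater
    then obtain d where d: "i = j + d" "d \<ge> 1" by (metis less_imp_add_positive One_nat_def Suc_leI)
    then have "\<bar>f (j, q) - f (i, p)\<bar> \<le> int M * int d" using dist[of d j q p] ij by simp
    then show ?thesis using mono[of d] d ij by (simp add: abs_minus_commute)
  next
    case equal
    have "\<bar>f (i, p) - f (i mod n + 1, p)\<bar> \<le> int M" "\<bar>f (i, q) - f (i mod n + 1, p)\<bar> \<le> int M"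
      using Lip_cyclic_edge[OF f] ij by auto
    then have "\<bar>f (i, p) - f (j, q)\<bar> \<le> int M * int 2"
      unfolding equal by linarith
    then show ?thesis using mono[OF n] by linarith
  qed
  moreover have "f v0 = 0" using f by (simp add: Lip_def)
  ultimately show ?thesis by (simp add: vw)
qed

section \<open>Functions of large range are rare\<close>

text \<open>
  The functions are grouped by their profile, the sequence of their layer spans. The functions
  with a given profile lie in a box, whose cardinality is a product of widths. The endpoints of the
  spans are bounded by \<open>M * n\<close> because \<open>f\<close> vanishes somewhere, so a profile is a walk in a set
  of \<open>(2Mn + 1)\<^sup>2\<close> pairs.
\<close>

lemma card_large_range_le:
  fixes M n k v0
  defines "G \<equiv> layered_cycle n k"
    and "\<delta> \<equiv> exp (- real k / (4 * (real M + 1)\<^sup>2))"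
    and "c \<equiv> (2 * real M * real n + 1)\<^sup>2"
  assumes n: "n \<ge> 2" and k: "k \<ge> 1" and v0: "v0 \<in> pverts G"
  shows "real (card {f \<in> Lip G v0 M. range_size G f > int M + 1})
    \<le> (real M + 1) ^ (n * k) * \<delta> * (c * (1 + c * \<delta>) ^ (n - 1))"
proof -
  define Bad where "Bad = {f \<in> Lip G v0 M. range_size G f > int M + 1}"
  define B where "B = int M * int n"
  define Y where "Y = {-B..B} \<times> {-B..B}"
  define prof where "prof f = restrict (layer_span k f) {1..n}" for f
  define box where "box s = (\<Pi>\<^sub>E v\<in>pverts G. {fst (s (fst v))..snd (s (fst v))})"
    for s :: "nat \<Rightarrow> int \<times> int"
  let ?W = "\<lambda>s. \<Prod>i\<in>{1..<n}. if s i = s (Suc i) then 1 else \<delta>"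
  have verts: "pverts G = {1..n} \<times> {1..k}" by (simp add: G_def layered_cycle_def)
  have nx: "i mod n + 1 \<in> {1..n}" if "i \<in> {1..n}" for i using that by (auto simp: Suc_le_eq)
  have profY: "prof ` Bad \<subseteq> {1..n} \<rightarrow>\<^sub>E Y"
  proof
    fix s assume "s \<in> prof ` Bad"
    then obtain f where f: "f \<in> Bad" "s = prof f" by blast
    have "layer_span k f i \<in> Y" if i: "i \<in> {1..n}" for i
    proof -
      obtain p q where pq: "p \<in> {1..k}" "f (i, p) = fst (layer_span k f i)"
        "q \<in> {1..k}" "f (i, q) = snd (layer_span k f i)"
        by (rule layer_span_attained[OF k])
      have "\<bar>f (i, r)\<bar> \<le> B" if "r \<in> {1..k}" for r
        using Lip_abs_le[of f n k v0 M "(i, r)"] f(1) that i n v0 verts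
        by (auto simp: Bad_def B_def G_def)
      from this[OF pq(1)] this[OF pq(3)] pq show ?thesis
        by (auto simp: Y_def mem_Times_iff abs_le_iff)
    qed
    then show "s \<in> {1..n} \<rightarrow>\<^sub>E Y" by (auto simp: f(2) prof_def)
  qed
  have finS: "finite ({1..n} \<rightarrow>\<^sub>E Y)" by (intro finite_PiE) (auto simp: Y_def)
  have cover: "Bad \<subseteq> (\<Union>s\<in>prof ` Bad. box s)"
  proof
    fix f assume f: "f \<in> Bad"
    then have "f \<in> extensional (pverts G)" by (auto simp: Bad_def Lip_def PiE_iff)
    then have "f \<in> box (prof f)"
      using layer_span_bounds[of _ k f] by (auto simp: box_def PiE_iff verts prof_def)
    then show "f \<in> (\<Union>s\<in>prof ` Bad. box s)" using f by blast
  qed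
  have box: "real (card (box s)) \<le> (real M + 1) ^ (n * k) * \<delta> * ?W s" if s_prof: "s \<in> prof ` Bad" for s
  proof -
    obtain f where f: "f \<in> Bad" "s = prof f" using s_prof by blast
    have s: "s i = layer_span k f i" if "i \<in> {1..n}" for i using that by (simp add: f(2) prof_def)
    have adm: "admissible M (s i) (s (i mod n + 1))" if "i \<in> {1..n}" for i
      using admissible_layer_span[of f n k v0 M i] that f(1) k s[OF that] s[OF nx[OF that]]
      by (simp add: Bad_def G_def)
    have defect: "\<exists>i\<in>{1..n}. \<not> saturated M (s i) (s (i mod n + 1))"
    proof (rule ccontr)
      assume none: "\<not> ?thesis"
      have "saturated M (layer_span k f i) (layer_span k f (i mod n + 1))" if "i \<in> {1..n}" for i
        using none that s[OF that, symmetric] s[OF nx[OF that], symmetric] by auto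
      then have "range_size G f \<le> int M + 1"
        unfolding G_def using n k by (intro saturated_imp_small_range) auto
      then show False using f(1) by (simp add: Bad_def)
    qed
    have card_width: "real (card {fst (s i)..snd (s i)}) = width (s i)" if "i \<in> {1..n}" for i
      using adm[OF that] by (simp add: admissible_def width_def)
    have "real (card (box s)) = (\<Prod>v\<in>{1..n} \<times> {1..k}. width (s (fst v)))"
      unfolding box_def verts by (subst card_PiE)
        (auto simp: of_nat_prod simp del: card_atLeastAtMost_int intro!: prod.cong card_width)
    also have "\<dots> = (\<Prod>i\<in>{1..n}. width (s i) ^ k)"
      using prod.cartesian_product[of "\<lambda>i _. width (s i)" "{1..k}" "{1..n}"]
      by (simp add: case_prod_unfold)
    also have "\<dots> \<le> (real M + 1) ^ (n * k) * \<delta> * ?W s"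
      using n adm defect \<delta>_def by (intro width_product_cycle_le) auto
    finally show ?thesis .
  qed
  have "real (card Bad) \<le> real (card (\<Union>s\<in>prof ` Bad. box s))"
    using finite_subset[OF profY finS]
    by (intro of_nat_mono card_mono cover finite_UN_I) (auto simp: box_def verts intro!: finite_PiE)
  also have "\<dots> \<le> real (\<Sum>s\<in>prof ` Bad. card (box s))"
    by (intro of_nat_mono card_UN_le finite_subset[OF profY finS])
  also have "\<dots> \<le> (\<Sum>s\<in>prof ` Bad. (real M + 1) ^ (n * k) * \<delta> * ?W s)"
    unfolding of_nat_sum by (intro sum_mono box)
  also have "\<dots> \<le> (\<Sum>s \<in> {1..n} \<rightarrow>\<^sub>E Y. (real M + 1) ^ (n * k) * \<delta> * ?W s)"
    by (intro sum_mono2 finS profY mult_nonneg_nonneg prod_nonneg) (auto simp: \<delta>_def)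
  also have "\<dots> = (real M + 1) ^ (n * k) * \<delta> * (\<Sum>s \<in> {1..n} \<rightarrow>\<^sub>E Y. ?W s)"
    by (simp only: sum_distrib_left)
  also have "\<dots> \<le> (real M + 1) ^ (n * k) * \<delta> * (card Y * (1 + card Y * \<delta>) ^ (n - 1))"
    using n by (intro mult_left_mono sum_walks_le) (auto simp: \<delta>_def Y_def)
  also have "real (card Y) = c"
    by (simp add: Y_def c_def B_def power2_eq_square card_cartesian_product mult.assoc)
  finally show ?thesis by (simp add: Bad_def)
qed

text \<open>
  Any values in \<open>{0..M}\<close> away from \<open>v0\<close>, together with the value \<open>0\<close> at \<open>v0\<close>, make a Lipschitz
  function. The factor \<open>M + 1\<close> on the right replaces the exponent \<open>n * k - 1\<close> on the left.
\<close>

lemma card_Lip_ge: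
  fixes n k
  defines "G \<equiv> layered_cycle n k"
  assumes v0: "v0 \<in> pverts G" and fin: "finite (Lip G v0 M)"
  shows "(real M + 1) ^ (n * k) \<le> (real M + 1) * real (card (Lip G v0 M))"
proof -
  have verts: "pverts G = {1..n} \<times> {1..k}" by (simp add: G_def layered_cycle_def)
  define A where "A v = (if v = v0 then {0} else {0..int M})" for v :: "nat \<times> nat"
  have A: "A v \<subseteq> {0..int M}" for v by (auto simp: A_def)
  have "Pi\<^sub>E (pverts G) A \<subseteq> Lip G v0 M"
  proof
    fix f assume f: "f \<in> Pi\<^sub>E (pverts G) A"
    have "0 \<le> f v \<and> f v \<le> int M" if "v \<in> pverts G" for v
      using f that A[of v] by (auto dest!: PiE_mem)
    moreover have "u \<in> pverts G \<and> v \<in> pverts G" if "(u, v) \<in> parcs G" for u v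
      using that by (auto simp: G_def layered_cycle_def)
    ultimately have "\<bar>f u - f v\<bar> \<le> int M" if "(u, v) \<in> parcs G" for u v
      using that by (smt (verit))
    moreover have "f v0 = 0" using f v0 by (auto simp: A_def dest!: PiE_mem)
    ultimately show "f \<in> Lip G v0 M" using f by (auto simp: Lip_def PiE_iff)
  qed
  then have "real (card (Pi\<^sub>E (pverts G) A)) \<le> real (card (Lip G v0 M))"
    by (intro of_nat_mono card_mono fin)
  moreover have "(real M + 1) * real (card (Pi\<^sub>E (pverts G) A)) = (real M + 1) ^ (n * k)"
  proof -
    have finV: "finite (pverts G)" by (simp add: verts)
    have "real (card (Pi\<^sub>E (pverts G) A)) = (\<Prod>v\<in>pverts G. real (card (A v)))"
      using finV by (simp add: card_PiE)
    also have "\<dots> = real (card (A v0)) * (\<Prod>v\<in>pverts G - {v0}. real (card (A v)))"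
      by (rule prod.remove[OF finV v0])
    also have "\<dots> = (\<Prod>v\<in>pverts G - {v0}. real M + 1)"
      by (simp add: A_def)
    finally have "(real M + 1) * real (card (Pi\<^sub>E (pverts G) A)) = (\<Prod>v\<in>pverts G. real M + 1)"
      using prod.remove[OF finV v0, of "\<lambda>_. real M + 1"] by simp
    also have "\<dots> = (real M + 1) ^ (n * k)"
      by (simp add: verts card_cartesian_product)
    finally show ?thesis .
  qed
  ultimately show ?thesis by (metis mult_left_mono of_nat_0_le_iff of_nat_1 of_nat_add)
qed

lemma prob_small_range_ge:
  fixes M n k v0
  defines "\<delta> \<equiv> exp (- real k / (4 * (real M + 1)\<^sup>2))"
    and "c \<equiv> (2 * real M * real n + 1)\<^sup>2"
  assumes n: "n \<ge> 2" and k: "k \<ge> 1" and v0: "v0 \<in> pverts (layered_cycle n k)"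
  shows "prob_small_range n k v0 M \<ge> 1 - (real M + 1) * \<delta> * (c * (1 + c * \<delta>) ^ (n - 1))"
proof -
  let ?G = "layered_cycle n k"
  let ?L = "Lip ?G v0 M"
  let ?E = "{f. range_size ?G f \<le> int M + 1}"
  define err where "err = \<delta> * (c * (1 + c * \<delta>) ^ (n - 1))"
  have err0: "err \<ge> 0" by (auto simp: err_def \<delta>_def c_def)
  interpret pair_graph ?G using n by (intro pair_graph_layered_cycle) auto
  have fin: "finite ?L"
    by (rule finite_Lip[OF pair_graph_axioms strongly_connected_layered_cycle[OF n k] v0])
  have ne: "?L \<noteq> {}" by (rule Lip_nonempty[OF _ v0]) unfold_locales
  have pos: "real (card ?L) > 0" using fin ne by (simp add: card_gt_0_iff)
  have prob: "prob_small_range n k v0 M = real (card (?L \<inter> ?E)) / real (card ?L)"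
    unfolding prob_small_range_def by (rule measure_pmf_of_set[OF ne fin])
  have "?L = (?L \<inter> ?E) \<union> {f \<in> ?L. range_size ?G f > int M + 1}" by auto
  then have "card ?L = card (?L \<inter> ?E) + card {f \<in> ?L. range_size ?G f > int M + 1}"
    using fin by (subst (1) \<open>?L = _\<close>, intro card_Un_disjoint) auto
  then have split: "real (card ?L) - real (card (?L \<inter> ?E))
      = real (card {f \<in> ?L. range_size ?G f > int M + 1})" by simp
  also have "\<dots> \<le> (real M + 1) ^ (n * k) * err"
    using card_large_range_le[OF n k v0, of M] by (simp add: err_def \<delta>_def c_def mult.assoc)
  also have "\<dots> \<le> (real M + 1) * real (card ?L) * err"
    by (intro mult_right_mono card_Lip_ge v0 fin err0)
  finally have "(1 - (real M + 1) * err) * real (card ?L) \<le> real (card (?L \<inter> ?E))"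
    by (simp add: algebra_simps)
  then show ?thesis
    unfolding prob using pos by (simp add: pos_le_divide_eq err_def mult.assoc)
qed

section \<open>The failure probability for large \<open>k\<close>\<close>

text \<open>
  With \<open>N = Mn\<close> and \<open>t = N\<^bsup>-\<gamma>/32\<^esup>\<close>, the hypothesis on \<open>k\<close> gives \<open>\<delta> \<le> t\<^sup>2\<close>, since
  \<open>(M + 1)\<^sup>2 \<le> 4M\<^sup>2\<close>. The remaining factors are polynomial: \<open>M + 1 \<le> 2N\<close>, \<open>c \<le> 9N\<^sup>2\<close>, and
  \<open>(1 + c\<delta>)\<^bsup>n-1\<^esup> \<le> exp (nc\<delta>) \<le> 3\<close>. Their product is at most \<open>54N\<^sup>3 \<le> N\<^sup>6\<close> because \<open>N \<ge> 4\<close>, and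
  \<open>\<gamma> \<ge> 192 = 6 * 32\<close> is what makes one factor \<open>t\<close> absorb \<open>N\<^sup>6\<close>.
\<close>

lemma failure_bound_le:
  fixes \<gamma> :: real and M n k :: nat
  defines "\<delta> \<equiv> exp (- real k / (4 * (real M + 1)\<^sup>2))"
    and "c \<equiv> (2 * real M * real n + 1)\<^sup>2"
  assumes \<gamma>: "\<gamma> \<ge> 192" and M: "M \<ge> 1" and n: "n \<ge> 4"
    and k: "real k > \<gamma> * real M ^ 2 * log 2 (real M * real n)"
  shows "(real M + 1) * \<delta> * (c * (1 + c * \<delta>) ^ (n - 1)) \<le> (real M * real n) powr (- \<gamma> / 32)"
proof -
  define N where "N = real M * real n"
  define t where "t = N powr (- \<gamma> / 32)"
  have "1 * 4 \<le> N" unfolding N_def using M n by (intro mult_mono) auto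
  then have N: "N \<ge> 4" by simp
  have Mn: "real M \<le> N" "real n \<le> N" using M n by (auto simp: N_def)
  have lnN: "ln N > 0" using N by simp
  have t0: "t > 0" using N by (simp add: t_def)
  have \<delta>t: "\<delta> \<le> t * t"
  proof -
    have "ln N \<le> log 2 N"
    proof -
      have "ln (2::real) \<le> 1" using ln_le_minus_one[of "2::real"] by simp
      then show ?thesis using lnN by (simp add: log_def le_divide_eq mult_left_le)
    qed
    then have "\<gamma> * (real M)\<^sup>2 * ln N \<le> \<gamma> * (real M)\<^sup>2 * log 2 N"
      using \<gamma> by (intro mult_left_mono) auto
    then have k': "\<gamma> * (real M)\<^sup>2 * ln N \<le> real k" using k by (simp add: N_def)
    have "(real M + 1)\<^sup>2 \<le> (2 * real M)\<^sup>2" using M by (intro power_mono) auto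
    then have "\<gamma> * ln N * (real M + 1)\<^sup>2 \<le> \<gamma> * ln N * (2 * real M)\<^sup>2"
      using \<gamma> lnN by (intro mult_left_mono) auto
    also have "\<dots> \<le> 4 * real k" using k' by (simp add: power_mult_distrib mult_ac)
    finally have "\<gamma> / 16 * ln N \<le> real k / (4 * (real M + 1)\<^sup>2)"
      by (simp add: pos_le_divide_eq add_pos_nonneg mult_ac)
    then have "\<delta> \<le> exp (- \<gamma> / 16 * ln N)" by (simp add: \<delta>_def)
    also have "\<dots> = t * t" using N by (simp add: t_def powr_def flip: exp_add)
    finally show ?thesis .
  qed
  have tN: "t * N ^ 6 \<le> 1"
  proof -
    have "t \<le> N powr (- 6)" unfolding t_def using N \<gamma> by (intro powr_mono) auto
    also have "\<dots> = inverse (N ^ 6)" using N by (simp add: powr_minus flip: powr_numeral)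
    finally show ?thesis using N by (simp add: field_simps)
  qed
  have c: "0 \<le> c" "c \<le> 9 * N\<^sup>2"
  proof -
    have "c = (2 * N + 1)\<^sup>2" by (simp add: c_def N_def)
    also have "\<dots> \<le> (3 * N)\<^sup>2" using N by (intro power_mono) auto
    finally show "c \<le> 9 * N\<^sup>2" by (simp add: power_mult_distrib)
  qed (simp add: c_def)
  have \<delta>0: "\<delta> \<ge> 0" by (simp add: \<delta>_def)
  have N3: "64 \<le> N ^ 3" using power_mono[OF N, of 3] by simp
  have \<delta>N: "54 * N ^ 3 * \<delta> \<le> t"
  proof -
    have "54 * N ^ 3 * \<delta> \<le> N ^ 3 * N ^ 3 * (t * t)"
      using N3 N \<delta>t \<delta>0 by (intro mult_mono) auto
    also have "\<dots> = t * (t * N ^ 6)" by (simp add: mult_ac flip: power_add)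
    also have "\<dots> \<le> t" using tN t0 by (simp add: mult_left_le)
    finally show ?thesis .
  qed
  have "(1 + c * \<delta>) ^ (n - 1) \<le> 3"
  proof -
    have t1: "t \<le> 1"
      using tN N t0 by (smt (verit) mult_le_cancel_left1 one_le_power)
    have "c * \<delta> * n \<le> 9 * N\<^sup>2 * \<delta> * N"
      using c \<delta>0 N Mn by (intro mult_mono) auto
    also have "\<dots> = 9 * N ^ 3 * \<delta>" by (simp add: power2_eq_square power3_eq_cube)
    also have "\<dots> \<le> 54 * N ^ 3 * \<delta>" using N \<delta>0 by (intro mult_right_mono) auto
    also have "\<dots> \<le> 1" using \<delta>N t1 by simp
    finally have cn: "n * (c * \<delta>) \<le> 1" by (simp add: mult_ac)
    have "(1 + c * \<delta>) ^ (n - 1) \<le> (1 + c * \<delta>) ^ n"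
      using c \<delta>0 by (intro power_increasing) auto
    also have "\<dots> \<le> exp (c * \<delta>) ^ n"
      using c \<delta>0 by (intro power_mono exp_ge_add_one_self) auto
    also have "\<dots> = exp (n * (c * \<delta>))" by (simp add: exp_of_nat_mult)
    also have "\<dots> \<le> exp 1" using cn by simp
    also have "\<dots> \<le> 3" by (rule exp_le)
    finally show ?thesis .
  qed
  then have "(real M + 1) * \<delta> * (c * (1 + c * \<delta>) ^ (n - 1)) \<le> (2 * N) * \<delta> * ((9 * N\<^sup>2) * 3)"
    using c \<delta>0 N Mn by (intro mult_mono) auto
  also have "\<dots> = 54 * N ^ 3 * \<delta>" by (simp add: power2_eq_square power3_eq_cube)
  also have "\<dots> \<le> t" by (rule \<delta>N)
  finally show ?thesis by (simp add: t_def N_def)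
qed

theorem theorem1p7:
  shows "\<exists>C K :: real. C > 0 \<and> K > 0 \<and> (\<forall>\<gamma> > C.
    (\<forall>(M :: nat) (k :: nat) (n :: nat) v0.
        M > 0 \<longrightarrow> k > 0 \<longrightarrow> even n \<longrightarrow> n \<ge> 4 \<longrightarrow>
        real k > \<gamma> * real M ^ 2 * log 2 (real M * real n) \<longrightarrow>
        v0 \<in> pverts (layered_cycle n k) \<longrightarrow>
        prob_small_range n k v0 M \<ge> 1 - K / \<gamma>)
    \<and>
    (\<forall>(M :: nat \<Rightarrow> nat) (k :: nat \<Rightarrow> nat) (v0 :: nat \<Rightarrow> nat \<times> nat).
        (\<forall>\<^sub>F n in even_at_top.
            M n > 0 \<and> k n > 0 \<and>
            real (k n) > \<gamma> * real (M n) ^ 2 * log 2 (real (M n) * real n) \<and>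
            v0 n \<in> pverts (layered_cycle n (k n))) \<longrightarrow>
        (\<lambda>n. log 2 (real (M n))) \<in> o[even_at_top](\<lambda>n. log 2 (real n)) \<longrightarrow>
        ((\<lambda>n. prob_small_range n (k n) (v0 n) (M n)) \<longlongrightarrow> 1) even_at_top))"
proof (rule exI[of _ 192], rule exI[of _ 32], intro conjI allI impI)
  fix \<gamma> :: real assume \<gamma>: "\<gamma> > 192"
  have bound: "prob_small_range n k v0 M \<ge> 1 - (real M * real n) powr (- \<gamma> / 32)"
    if "M > 0" "k > 0" "n \<ge> 4" "real k > \<gamma> * real M ^ 2 * log 2 (real M * real n)"
      "v0 \<in> pverts (layered_cycle n k)" for M k n v0
    using prob_small_range_ge[of n k v0 M] failure_bound_le[of \<gamma> M n k] that \<gamma> by simp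
  show "prob_small_range n k v0 M \<ge> 1 - 32 / \<gamma>"
    if "M > 0" "k > 0" "even n" "n \<ge> 4" "real k > \<gamma> * real M ^ 2 * log 2 (real M * real n)"
      "v0 \<in> pverts (layered_cycle n k)" for M k n v0
  proof -
    let ?N = "real M * real n"
    \<comment> \<open>For \<open>N \<ge> e\<close> the power \<open>N\<^bsup>\<gamma>/32\<^esup>\<close> is at least \<open>exp (\<gamma>/32) \<ge> \<gamma>/32\<close>.\<close>
    have "1 * 4 \<le> ?N" using that by (intro mult_mono) auto
    then have N: "?N \<ge> 4" by simp
    then have "exp 1 \<le> ?N" using exp_le by simp
    then have "ln ?N \<ge> 1" using N by (subst ln_ge_iff) auto
    then have "1 + \<gamma> / 32 * 1 \<le> 1 + \<gamma> / 32 * ln ?N"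
      using \<gamma> by (intro add_left_mono mult_left_mono) auto
    also have "\<dots> \<le> exp (\<gamma> / 32 * ln ?N)" by (rule exp_ge_add_one_self)
    also have "\<dots> = ?N powr (\<gamma> / 32)" using that by (simp add: powr_def)
    finally have "\<gamma> / 32 \<le> ?N powr (\<gamma> / 32)" by simp
    then have "inverse (?N powr (\<gamma> / 32)) \<le> inverse (\<gamma> / 32)"
      using \<gamma> by (intro le_imp_inverse_le) auto
    then have "?N powr (- \<gamma> / 32) \<le> 32 / \<gamma>" by (simp add: powr_minus)
    then show ?thesis using bound[of M k n v0] that by linarith
  qed
  show "((\<lambda>n. prob_small_range n (k n) (v0 n) (M n)) \<longlongrightarrow> 1) even_at_top"
    if ev: "\<forall>\<^sub>F n in even_at_top. M n > 0 \<and> k n > 0 \<and>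
        real (k n) > \<gamma> * real (M n) ^ 2 * log 2 (real (M n) * real n) \<and>
        v0 n \<in> pverts (layered_cycle n (k n))"
      and "(\<lambda>n. log 2 (real (M n))) \<in> o[even_at_top](\<lambda>n. log 2 (real n))"
    for M k :: "nat \<Rightarrow> nat" and v0 :: "nat \<Rightarrow> nat \<times> nat"
  proof (rule tendsto_sandwich)
    have le: "even_at_top \<le> at_top" by (simp add: even_at_top_def)
    have "((\<lambda>n. 1 - 1 / real n) \<longlongrightarrow> 1 - 0) sequentially"
      by (intro tendsto_intros lim_1_over_n)
    then show "((\<lambda>n. 1 - 1 / real n) \<longlongrightarrow> 1) even_at_top"
      using tendsto_mono[OF le] by simp
    have "\<forall>\<^sub>F n in even_at_top. n \<ge> 4"
      using eventually_ge_at_top[of "4::nat"] le by (rule filter_leD[rotated])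
    with ev show "\<forall>\<^sub>F n in even_at_top. 1 - 1 / real n \<le> prob_small_range n (k n) (v0 n) (M n)"
    proof eventually_elim
      case (elim n)
      let ?N = "real (M n) * real n"
      have Nn: "real n \<le> ?N" using elim by auto
      moreover have "real n \<ge> 4" using elim by simp
      ultimately have "?N \<ge> 1" by linarith
      have "?N powr (- \<gamma> / 32) \<le> ?N powr (- 1)"
        using \<gamma> \<open>?N \<ge> 1\<close> by (intro powr_mono) auto
      also have "\<dots> = 1 / ?N" by (simp add: powr_minus_divide)
      also have "\<dots> \<le> 1 / real n" using elim Nn by (intro divide_left_mono) auto
      finally show ?case using bound[of "M n" "k n" n "v0 n"] elim by linarith
    qed
    show "\<forall>\<^sub>F n in even_at_top. prob_small_range n (k n) (v0 n) (M n) \<le> 1"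
      by (simp add: prob_small_range_def)
  qed simp
qed simp_all

end
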